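(* There exists an optimal solution for an arbitrary instance of the CAPCAB that can be identified by solving the mixed-integer nonlinear formulation (M) given in the context while setting compensation values equal to $$C_{ij}^* = \operatorname{argmin}_{C_{ij}\ge 0} P_{ij}(C_{ij}) (C_{ij} - c'_i)$$ for each task $i\in I$ and every occasional driver $j\in J$.
   Context: An instance of the Crowdshipping Assignment Problem with Compensation-Driven Acceptance Behavior (CAPCAB) consists of a finite set $I$ of tasks, a finite set $J$ of occasional drivers, costs $c_i'\ge c_i\ge 0$ for each $i\in I$ ($c_i$ is the cost of having task $i$ performed by a professional driver, $c_i'$ the penalized cost incurred if task $i$ is refused by an occasional driver), and, for each $i\in I$, $j\in J$, an acceptance probability function $P_{ij}:[0,\infty)\to[0,1]$ with $P_{ij}(0)=0$, where $P_{ij}(C_{ij})$ is the probability that driver $j$ accepts task $i$ when offered compensation $C_{ij}$. The functions are separable: the probability that $j$ accepts $i$ does not depend on other tasks, on compensations offered to other drivers, or on other drivers' acceptance decisions. A feasible solution consists of a one-to-one assignment $A\subseteq I\times J$ of offered pairs (each task and each driver occurs in at most one pair of $A$) and compensations $C_{ij}\ge 0$. There are no further constraints on the operator's choice. Let $I_{\mathrm o}=\{i : (i,j)\in A \text{ for some } j\}$. The expected total cost of the solution is $$\sum_{i\in I\setminus I_{\mathrm o}} c_i+\sum_{(i,j)\in A}\bigl(P_{ij}(C_{ij})\,C_{ij}+(1-P_{ij}(C_{ij}))\,c_i'\bigr),$$ and an optimal solution is a feasible solution of minimum expected total cost. Formulation (M) of the CAPCAB uses variables $y_i$ ($y_i=1$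 iff task $i$ is performed by a professional driver), $x_{ij}$ ($x_{ij}=1$ iff task $i$ is offered to driver $j$) and $C_{ij}$ (the compensation offered to $j$ for $i$), and given upper bounds $U_{ij}$ on the compensation offered (the cost $c_i$ can always be used as such an upper bound): $$\min\ \sum_{i\in I}\Bigl(c_i y_i+\sum_{j\in J}\bigl(P_{ij}(C_{ij})C_{ij}+(1-P_{ij}(C_{ij}))c'_i\bigr)x_{ij}\Bigr)$$ subject to $\sum_{i\in I}x_{ij}\le 1$ for $j\in J$; $\sum_{j\in J}x_{ij}+y_i=1$ for $i\in I$; $C_{ij}\le U_{ij}x_{ij}$, $x_{ij}\in\{0,1\}$ and $C_{ij}\ge 0$ for $i\in I$, $j\in J$; $y_i\in\{0,1\}$ for $i\in I$.
   Formalization: The minimum defining each C*_ij is assumed attained (it fails, e.g., if P_ij(C)=1 for all C>0), and in (M) the values C_ij=C*_ij are imposed only on offered pairs (x_ij=1), since C_ij ≤ U_ij x_ij forces C_ij=0 on the others. *)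

theory Defs
  imports Complex_Main
begin

text \<open>The values of the acceptance functions at negative arguments are irrelevant; only
  \<open>[0,\<infinity>)\<close> is ever consulted.\<close>

locale capcab =
  fixes I :: "'i set" and J :: "'j set"
    and c c' :: "'i \<Rightarrow> real"
    and P :: "'i \<Rightarrow> 'j \<Rightarrow> real \<Rightarrow> real"
  assumes finite_tasks: "finite I"
    and finite_drivers: "finite J"
    and cost_nonneg: "i \<in> I \<Longrightarrow> 0 \<le> c i"
    and cost_le_penalized: "i \<in> I \<Longrightarrow> c i \<le> c' i"
    and prob_range: "\<lbrakk>i \<in> I; j \<in> J; 0 \<le> C\<rbrakk> \<Longrightarrow> P i j C \<in> {0..1}"
    and prob_zero: "\<lbrakk>i \<in> I; j \<in> J\<rbrakk> \<Longrightarrow> P i j 0 = 0"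
begin

definition offer_cost :: "'i \<Rightarrow> 'j \<Rightarrow> real \<Rightarrow> real" where
  "offer_cost i j C = P i j C * C + (1 - P i j C) * c' i"

text \<open>A solution is a pair of an assignment and compensations. Compensations of pairs outside
  the assignment do not influence the cost.\<close>

definition feasible_solution :: "('i \<times> 'j) set \<times> ('i \<Rightarrow> 'j \<Rightarrow> real) \<Rightarrow> bool" where
  "feasible_solution = (\<lambda>(A, C). A \<subseteq> I \<times> J \<and> inj_on fst A \<and> inj_on snd A \<and>
     (\<forall>i\<in>I. \<forall>j\<in>J. 0 \<le> C i j))"

definition expected_total_cost :: "('i \<times> 'j) set \<times> ('i \<Rightarrow> 'j \<Rightarrow> real) \<Rightarrow> real" where
  "expected_total_cost = (\<lambda>(A, C).
     (\<Sum>i\<in>I - fst ` A. c i) + (\<Sum>(i, j)\<in>A. offer_cost i j (C i j)))"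

definition optimal_solution :: "('i \<times> 'j) set \<times> ('i \<Rightarrow> 'j \<Rightarrow> real) \<Rightarrow> bool" where
  "optimal_solution = is_arg_min expected_total_cost feasible_solution"

text \<open>\<open>U i j\<close> bounds the compensations worth offering: an offer above it is either no cheaper
  than the professional driver or strictly more expensive than some offer within the bound.\<close>

definition compensation_bounds :: "('i \<Rightarrow> 'j \<Rightarrow> real) \<Rightarrow> bool" where
  "compensation_bounds U \<longleftrightarrow> (\<forall>i\<in>I. \<forall>j\<in>J. \<forall>C\<ge>0. U i j < C \<longrightarrow>
     c i \<le> offer_cost i j C \<or> (\<exists>C'\<in>{0..U i j}. offer_cost i j C' < offer_cost i j C))"

lemma compensation_bounds_if_cost_le:
  assumes "\<And>i j. i \<in> I \<Longrightarrow> j \<in> J \<Longrightarrow> c i \<le> U i j"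
  shows "compensation_bounds U"
  unfolding compensation_bounds_def
proof (intro ballI allI impI disjI1)
  fix i j C assume ij: "i \<in> I" "j \<in> J" and C: "0 \<le> C" "U i j < C"
  have p: "0 \<le> P i j C" "P i j C \<le> 1" using prob_range ij C by auto
  have "P i j C * c i \<le> P i j C * C"
    using assms[OF ij] C p by (intro mult_left_mono) auto
  moreover have "(1 - P i j C) * c i \<le> (1 - P i j C) * c' i"
    using cost_le_penalized ij p by (intro mult_left_mono) auto
  ultimately show "c i \<le> offer_cost i j C"
    unfolding offer_cost_def by (simp add: algebra_simps)
qed

text \<open>Points \<open>(x, y, C)\<close> of the mixed-integer nonlinear formulation (M): \<open>x i j = 1\<close> iff task
  \<open>i\<close> is offered to \<open>j\<close>, and \<open>y i = 1\<close> iff a professional driver performs \<open>i\<close>.\<close>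

definition M_objective ::
    "('i \<Rightarrow> 'j \<Rightarrow> real) \<times> ('i \<Rightarrow> real) \<times> ('i \<Rightarrow> 'j \<Rightarrow> real) \<Rightarrow> real" where
  "M_objective = (\<lambda>(x, y, C).
     \<Sum>i\<in>I. c i * y i + (\<Sum>j\<in>J. (P i j (C i j) * C i j + (1 - P i j (C i j)) * c' i) * x i j))"

definition M_feasible ::
    "('i \<Rightarrow> 'j \<Rightarrow> real) \<Rightarrow>
     ('i \<Rightarrow> 'j \<Rightarrow> real) \<times> ('i \<Rightarrow> real) \<times> ('i \<Rightarrow> 'j \<Rightarrow> real) \<Rightarrow> bool" where
  "M_feasible U = (\<lambda>(x, y, C).
     (\<forall>j\<in>J. (\<Sum>i\<in>I. x i j) \<le> 1) \<and>
     (\<forall>i\<in>I. (\<Sum>j\<in>J. x i j) + y i = 1) \<and>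
     (\<forall>i\<in>I. \<forall>j\<in>J. C i j \<le> U i j * x i j \<and> x i j \<in> {0, 1} \<and> 0 \<le> C i j) \<and>
     (\<forall>i\<in>I. y i \<in> {0, 1}))"

text \<open>Optimality in (M) with the compensations set to \<open>Cs\<close>. They are prescribed for the offered
  pairs only, because the constraint \<open>C i j \<le> U i j * x i j\<close> forces \<open>C i j = 0\<close> on the others.\<close>

definition M_optimal_with ::
    "('i \<Rightarrow> 'j \<Rightarrow> real) \<Rightarrow> ('i \<Rightarrow> 'j \<Rightarrow> real) \<Rightarrow>
     ('i \<Rightarrow> 'j \<Rightarrow> real) \<times> ('i \<Rightarrow> real) \<times> ('i \<Rightarrow> 'j \<Rightarrow> real) \<Rightarrow> bool" where
  "M_optimal_with U Cs = is_arg_min M_objective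
     (\<lambda>(x, y, C). M_feasible U (x, y, C) \<and> (\<forall>i\<in>I. \<forall>j\<in>J. x i j = 1 \<longrightarrow> C i j = Cs i j))"

definition M_solution ::
    "('i \<Rightarrow> 'j \<Rightarrow> real) \<times> ('i \<Rightarrow> real) \<times> ('i \<Rightarrow> 'j \<Rightarrow> real) \<Rightarrow>
     ('i \<times> 'j) set \<times> ('i \<Rightarrow> 'j \<Rightarrow> real)" where
  "M_solution = (\<lambda>(x, y, C). ({(i, j) \<in> I \<times> J. x i j = 1}, C))"

end

end

(* Since offer_cost i j C = c' i + P i j C * (C - c' i), the prescribed compensation minimises the
   cost of offering i to j independently of all other decisions. A pair whose prescribed compensation
   exceeds U i j is never cheaper than the professional driver, so dropping such pairs from an
   assignment does not raise its cost. Hence every solution is dominated by one with the prescribed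
   compensations that is feasible for (M), and only finitely many assignments remain. *)

theory Submission
  imports Defs
begin

context capcab
begin

lemma expected_total_cost_eq_sum_savings:
  assumes "A \<subseteq> I \<times> J" and inj: "inj_on fst A"
  shows "expected_total_cost (A, C) = (\<Sum>i\<in>I. c i) + (\<Sum>(i, j)\<in>A. offer_cost i j (C i j) - c i)"
proof -
  have "(\<Sum>i\<in>I. c i) = (\<Sum>i\<in>I - fst ` A. c i) + (\<Sum>i\<in>fst ` A. c i)"
    using assms(1) by (intro sum.subset_diff finite_tasks) auto
  also have "(\<Sum>i\<in>fst ` A. c i) = (\<Sum>(i, j)\<in>A. c i)"
    by (simp add: sum.reindex[OF inj] case_prod_unfold)
  finally show ?thesis
    by (simp add: expected_total_cost_def case_prod_unfold sum_subtractf)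
qed

lemma expected_total_cost_cong:
  assumes "\<And>i j. (i, j) \<in> A \<Longrightarrow> C i j = C' i j"
  shows "expected_total_cost (A, C) = expected_total_cost (A, C')"
  unfolding expected_total_cost_def using assms by (auto intro!: sum.cong)

lemma offer_cost_eq: "offer_cost i j C = c' i + P i j C * (C - c' i)"
  by (simp add: offer_cost_def algebra_simps)

text \<open>The two functions differ by the constant \<open>c' i\<close>, which does not move
  minimisers.\<close>

lemma is_arg_min_offer_cost_iff:
  "is_arg_min (\<lambda>C. P i j C * (C - c' i)) S C \<longleftrightarrow> is_arg_min (offer_cost i j) S C"
  by (simp add: is_arg_min_def offer_cost_eq)

text \<open>The column constraints bound the offers per driver directly. For tasks the bound comes
  from the row equation together with \<open>y i\<close> being 0 or 1.\<close>

lemma M_solution_feasible: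
  assumes "M_feasible U s"
  shows "feasible_solution (M_solution s)"
proof -
  obtain x y C where s: "s = (x, y, C)" by (cases s)
  have x01: "\<And>i j. i \<in> I \<Longrightarrow> j \<in> J \<Longrightarrow> x i j = 0 \<or> x i j = 1"
    and col: "\<And>j. j \<in> J \<Longrightarrow> (\<Sum>i\<in>I. x i j) \<le> 1"
    and row: "\<And>i. i \<in> I \<Longrightarrow> (\<Sum>j\<in>J. x i j) + y i = 1"
    and y01: "\<And>i. i \<in> I \<Longrightarrow> y i = 0 \<or> y i = 1"
    and C: "\<And>i j. i \<in> I \<Longrightarrow> j \<in> J \<Longrightarrow> 0 \<le> C i j"
    using assms by (auto simp: s M_feasible_def)
  \<comment> \<open>Used for rows and columns alike: the terms are nonnegative, so two ones would
    push the sum to at least 2.\<close>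
  have two: False
    if "finite S" "sum f S \<le> 1" "\<And>a. a \<in> S \<Longrightarrow> f a = 0 \<or> f a = 1"
      "a \<in> S" "b \<in> S" "a \<noteq> b" "f a = 1" "f b = 1" for f :: "'z \<Rightarrow> real" and S a b
  proof -
    have "sum f {a, b} \<le> sum f S"
      using that(1,3-5) by (intro sum_mono2) force+
    then show False using that by simp
  qed
  have "(\<Sum>j\<in>J. x i j) \<le> 1" if "i \<in> I" for i
    using row[OF that] y01[OF that] by linarith
  then have "j = j'" if "i \<in> I" "j \<in> J" "j' \<in> J" "x i j = 1" "x i j' = 1" for i j j'
    using two[of J "x i" j j'] finite_drivers x01 that by blast
  moreover have "i = i'" if "i \<in> I" "i' \<in> I" "j \<in> J" "x i j = 1" "x i' j = 1" for i i' j
    using two[of I "\<lambda>i. x i j" i i'] finite_tasks x01 col that by blast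
  ultimately show ?thesis
    using C by (auto simp: s M_solution_def feasible_solution_def inj_on_def)
qed

lemma M_objective_eq_expected_total_cost:
  assumes feas: "M_feasible U s"
  shows "M_objective s = expected_total_cost (M_solution s)"
proof -
  obtain x y C where s: "s = (x, y, C)" by (cases s)
  let ?A = "{(i, j) \<in> I \<times> J. x i j = 1}"
  let ?d = "\<lambda>i j. offer_cost i j (C i j) - c i"
  have x01: "\<And>i j. i \<in> I \<Longrightarrow> j \<in> J \<Longrightarrow> x i j = 0 \<or> x i j = 1"
    and row: "\<And>i. i \<in> I \<Longrightarrow> y i = 1 - (\<Sum>j\<in>J. x i j)"
    using feas by (auto simp: s M_feasible_def algebra_simps)
  have "M_objective s = (\<Sum>i\<in>I. c i * y i + (\<Sum>j\<in>J. offer_cost i j (C i j) * x i j))"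
    by (simp add: s M_objective_def offer_cost_def)
  \<comment> \<open>Eliminating \<open>y i\<close> through the row equation moves a
    \<open>- c i\<close> into the coefficient of every \<open>x i j\<close>, which yields the terms
    of the baseline formula.\<close>
  also have "\<dots> = (\<Sum>i\<in>I. c i + (\<Sum>j\<in>J. ?d i j * x i j))"
    by (intro sum.cong refl) (simp add: row algebra_simps sum_subtractf sum_distrib_left)
  also have "\<dots> = (\<Sum>i\<in>I. c i) + (\<Sum>(i, j)\<in>I \<times> J. ?d i j * x i j)"
    by (simp add: sum.distrib sum.cartesian_product)
  also have "(\<Sum>(i, j)\<in>I \<times> J. ?d i j * x i j) = (\<Sum>(i, j)\<in>?A. ?d i j)"
    using finite_tasks finite_drivers x01 by (intro sum.mono_neutral_cong_right) force+
  also have "(\<Sum>i\<in>I. c i) + \<dots> = expected_total_cost (?A, C)"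
    using M_solution_feasible[OF feas]
    by (intro expected_total_cost_eq_sum_savings[symmetric])
      (auto simp: s M_solution_def feasible_solution_def)
  finally show ?thesis by (simp add: s M_solution_def)
qed

text \<open>For \<open>A\<close> inside \<open>I \<times> J\<close>, a section of
  \<open>M_solution\<close>: the assignment is recovered exactly, the compensations only on
  \<open>A\<close>, which is all that the cost depends on.\<close>

definition M_point ::
    "('i \<Rightarrow> 'j \<Rightarrow> real) \<Rightarrow> ('i \<times> 'j) set \<Rightarrow>
     ('i \<Rightarrow> 'j \<Rightarrow> real) \<times> ('i \<Rightarrow> real) \<times> ('i \<Rightarrow> 'j \<Rightarrow> real)" where
  "M_point Cs A = (\<lambda>i j. of_bool ((i, j) \<in> A), \<lambda>i. of_bool (i \<notin> fst ` A),
     \<lambda>i j. if (i, j) \<in> A then Cs i j else 0)"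

lemma M_point_feasible:
  assumes feas: "feasible_solution (A, Cs)" and U: "\<And>i j. (i, j) \<in> A \<Longrightarrow> Cs i j \<le> U i j"
  shows "M_feasible U (M_point Cs A)"
proof -
  have A: "A \<subseteq> I \<times> J" "inj_on fst A" "inj_on snd A"
    and Cs: "\<And>i j. i \<in> I \<Longrightarrow> j \<in> J \<Longrightarrow> 0 \<le> Cs i j"
    using feas by (auto simp: feasible_solution_def)
  have "(\<Sum>i\<in>I. of_bool ((i, j) \<in> A) :: real) \<le> 1" for j
  proof (cases "\<exists>k. (k, j) \<in> A")
    case True
    then obtain k where "(k, j) \<in> A" by blast
    then have "(i, j) \<in> A \<longleftrightarrow> i = k" for i
      using inj_onD[OF A(3), of "(i, j)" "(k, j)"] by auto
    then show ?thesis using finite_tasks by (cases "k \<in> I") simp_all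
  qed simp
  moreover have "(\<Sum>j\<in>J. of_bool ((i, j) \<in> A) :: real) + of_bool (i \<notin> fst ` A) = 1" for i
  proof (cases "\<exists>k. (i, k) \<in> A")
    case True
    then obtain k where k: "(i, k) \<in> A" by blast
    then have "(i, j) \<in> A \<longleftrightarrow> j = k" for j
      using inj_onD[OF A(2), of "(i, j)" "(i, k)"] by auto
    moreover have "i \<in> fst ` A" "k \<in> J" using k A(1) by force+
    ultimately show ?thesis using finite_drivers by simp
  next
    case False
    then have "i \<notin> fst ` A" by auto
    with False show ?thesis by simp
  qed
  ultimately show ?thesis
    using U Cs by (simp add: M_feasible_def M_point_def)
qed

lemma expected_total_cost_M_solution_M_point:
  assumes "A \<subseteq> I \<times> J"
  shows "expected_total_cost (M_solution (M_point Cs A)) = expected_total_cost (A, Cs)"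
proof -
  have "{(i, j) \<in> I \<times> J. (of_bool ((i, j) \<in> A) :: real) = 1} = A"
    using assms by auto
  then show ?thesis
    by (simp add: M_solution_def M_point_def) (rule expected_total_cost_cong, simp)
qed

context
  fixes U Cs :: "'i \<Rightarrow> 'j \<Rightarrow> real"
  assumes bounds: "compensation_bounds U"
    and arg_min: "\<And>i j. i \<in> I \<Longrightarrow> j \<in> J \<Longrightarrow> is_arg_min (offer_cost i j) (\<lambda>C. 0 \<le> C) (Cs i j)"
begin

text \<open>The pairs left out of \<open>A'\<close> are those whose prescribed compensation would
  violate the bound in (M), so \<open>A'\<close> with \<open>Cs\<close> can be encoded by
  \<open>M_point\<close>.\<close>

lemma feasible_solution_improve:
  assumes feas: "feasible_solution (A, C)"
  defines "A' \<equiv> {(i, j) \<in> A. Cs i j \<le> U i j}"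
  shows "feasible_solution (A', Cs)" "expected_total_cost (A', Cs) \<le> expected_total_cost (A, C)"
proof -
  have A: "A \<subseteq> I \<times> J" "inj_on fst A" "inj_on snd A"
    and C: "\<And>i j. i \<in> I \<Longrightarrow> j \<in> J \<Longrightarrow> 0 \<le> C i j"
    using feas by (auto simp: feasible_solution_def)
  have A': "A' \<subseteq> A" by (auto simp: A'_def)
  have nonneg: "0 \<le> Cs i j" and le: "\<And>D. 0 \<le> D \<Longrightarrow> offer_cost i j (Cs i j) \<le> offer_cost i j D"
    if "i \<in> I" "j \<in> J" for i j
    using arg_min[OF that] by (auto simp: is_arg_min_def not_less)
  have inj': "inj_on fst A'" "inj_on snd A'"
    using A A' by (auto intro: inj_on_subset)
  show "feasible_solution (A', Cs)"
    using A A' inj' nonneg by (auto simp: feasible_solution_def)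
  \<comment> \<open>No offer is strictly cheaper than the minimiser, so of the two alternatives in
    \<open>compensation_bounds\<close> only the comparison with \<open>c i\<close> remains.\<close>
  have dropped: "c i \<le> offer_cost i j (Cs i j)" if "i \<in> I" "j \<in> J" "U i j < Cs i j" for i j
  proof -
    have "\<not> (\<exists>D\<in>{0..U i j}. offer_cost i j D < offer_cost i j (Cs i j))"
      using le[OF that(1,2)] by (auto simp: not_less)
    then show ?thesis
      using bounds nonneg that unfolding compensation_bounds_def by blast
  qed
  have "finite A"
    using A(1) finite_tasks finite_drivers by (meson finite_SigmaI finite_subset)
  \<comment> \<open>By \<open>dropped\<close>, the summands over \<open>A - A'\<close> are
    nonnegative.\<close>
  then have "(\<Sum>(i, j)\<in>A'. offer_cost i j (Cs i j) - c i) \<le> (\<Sum>(i, j)\<in>A. offer_cost i j (Cs i j) - c i)"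
    using A A' dropped by (intro sum_mono2) (force simp: A'_def not_le)+
  also have "\<dots> \<le> (\<Sum>(i, j)\<in>A. offer_cost i j (C i j) - c i)"
    using A C le by (intro sum_mono) auto
  finally show "expected_total_cost (A', Cs) \<le> expected_total_cost (A, C)"
    using A A' inj' by (simp add: expected_total_cost_eq_sum_savings subset_trans[OF A'])
qed

text \<open>The competitor \<open>(A, C)\<close> is arbitrary and may exceed \<open>U\<close>, so it
  is first improved to \<open>(A', Cs)\<close>, whose encoding is among the points over which
  \<open>s\<close> is optimal.\<close>

lemma optimal_solution_M_solution:
  assumes "M_optimal_with U Cs s"
  shows "optimal_solution (M_solution s)"
proof -
  have s: "M_feasible U s"
    using assms by (auto simp: M_optimal_with_def is_arg_min_def)
  have opt: "M_objective s \<le> M_objective (x, y, C)"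
    if "M_feasible U (x, y, C)"
      and "\<And>i j. i \<in> I \<Longrightarrow> j \<in> J \<Longrightarrow> x i j = 1 \<Longrightarrow> C i j = Cs i j" for x y C
    using assms[unfolded M_optimal_with_def is_arg_min_def, THEN conjunct2] that
    by (simp only: not_ex de_Morgan_conj not_less split_paired_All case_prod_conv) blast
  have "expected_total_cost (M_solution s) \<le> expected_total_cost (A, C)"
    if feas: "feasible_solution (A, C)" for A C
  proof -
    define A' where "A' = {(i, j) \<in> A. Cs i j \<le> U i j}"
    note A' = feasible_solution_improve[OF feas, folded A'_def]
    have p: "M_feasible U (M_point Cs A')"
      by (rule M_point_feasible[OF A'(1)]) (simp add: A'_def)
    have "expected_total_cost (M_solution s) = M_objective s"
      using M_objective_eq_expected_total_cost[OF s] by simp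
    also have "\<dots> \<le> M_objective (M_point Cs A')"
      using p unfolding M_point_def by (rule opt) (simp split: if_splits)
    also have "\<dots> = expected_total_cost (A', Cs)"
      using A'(1) expected_total_cost_M_solution_M_point[of A' Cs]
      by (simp add: M_objective_eq_expected_total_cost[OF p] feasible_solution_def)
    also have "\<dots> \<le> expected_total_cost (A, C)" by (rule A'(2))
    finally show ?thesis .
  qed
  then show ?thesis
    using M_solution_feasible[OF s] by (force simp: optimal_solution_def is_arg_min_def not_less)
qed

text \<open>With the compensations prescribed, the objective depends on the assignment alone, so a
  minimum over a finite family suffices.\<close>

lemma ex_M_optimal_with: "\<exists>s. M_optimal_with U Cs s"
proof -
  \<comment> \<open>These are the assignments arising from points of (M) with compensations
    \<open>Cs\<close>. The empty one always belongs to \<open>F\<close>, whatever \<open>U\<close>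
    is.\<close>
  define F where "F = {A. feasible_solution (A, Cs) \<and> (\<forall>(i, j)\<in>A. Cs i j \<le> U i j)}"
  have nonneg: "0 \<le> Cs i j" if "i \<in> I" "j \<in> J" for i j
    using arg_min[OF that] by (auto simp: is_arg_min_def)
  have "F \<subseteq> Pow (I \<times> J)" by (auto simp: F_def feasible_solution_def)
  then have "finite F" by (rule finite_subset) (simp add: finite_tasks finite_drivers)
  moreover have "{} \<in> F" using nonneg by (simp add: F_def feasible_solution_def)
  ultimately obtain A where A: "A \<in> F"
    and min: "\<And>B. B \<in> F \<Longrightarrow> expected_total_cost (A, Cs) \<le> expected_total_cost (B, Cs)"
    using ex_is_arg_min_if_finite[of F "\<lambda>A. expected_total_cost (A, Cs)"]
    by (auto simp: is_arg_min_def not_less)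
  have p: "M_feasible U (M_point Cs A)"
    using A by (intro M_point_feasible) (auto simp: F_def)
  have "M_objective (M_point Cs A) \<le> M_objective (x, y, C)"
    if s: "M_feasible U (x, y, C)"
      and C: "\<And>i j. i \<in> I \<Longrightarrow> j \<in> J \<Longrightarrow> x i j = 1 \<Longrightarrow> C i j = Cs i j" for x y C
  proof -
    let ?B = "{(i, j) \<in> I \<times> J. x i j = 1}"
    \<comment> \<open>On offered pairs the linking constraint of (M) reads
      \<open>C i j \<le> U i j\<close>, and there \<open>C\<close> equals \<open>Cs\<close>; this
      places \<open>?B\<close> in \<open>F\<close>.\<close>
    have "Cs i j \<le> U i j" if "i \<in> I" "j \<in> J" "x i j = 1" for i j
    proof -
      have "C i j \<le> U i j * x i j" using s that(1,2) by (simp add: M_feasible_def)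
      then show ?thesis using C that by simp
    qed
    then have "?B \<in> F"
      using M_solution_feasible[OF s] nonneg
      by (auto simp: F_def M_solution_def feasible_solution_def)
    have "M_objective (M_point Cs A) = expected_total_cost (A, Cs)"
      using A expected_total_cost_M_solution_M_point[of A Cs]
      by (simp add: M_objective_eq_expected_total_cost[OF p] F_def feasible_solution_def)
    also have "\<dots> \<le> expected_total_cost (?B, Cs)"
      by (rule min) fact
    also have "\<dots> = expected_total_cost (?B, C)"
      by (rule expected_total_cost_cong) (auto simp: C)
    also have "\<dots> = M_objective (x, y, C)"
      by (simp add: M_objective_eq_expected_total_cost[OF s] M_solution_def)
    finally show ?thesis .
  qed
  then have "M_optimal_with U Cs (M_point Cs A)"
    using p by (force simp: M_optimal_with_def is_arg_min_def not_less M_point_def split: if_splits)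
  then show ?thesis ..
qed

end

end

theorem corollary1:
  fixes I :: "'i set" and J :: "'j set"
    and c c' :: "'i \<Rightarrow> real"
    and P :: "'i \<Rightarrow> 'j \<Rightarrow> real \<Rightarrow> real"
    and U Cstar :: "'i \<Rightarrow> 'j \<Rightarrow> real"
  assumes "capcab I J c c' P"
    and "capcab.compensation_bounds I J c c' P U"
    and "\<And>i j. i \<in> I \<Longrightarrow> j \<in> J \<Longrightarrow>
           is_arg_min (\<lambda>C. P i j C * (C - c' i)) (\<lambda>C. 0 \<le> C) (Cstar i j)"
  shows "(\<exists>s. capcab.M_optimal_with I J c c' P U Cstar s) \<and>
         (\<forall>s. capcab.M_optimal_with I J c c' P U Cstar s \<longrightarrow>
              capcab.optimal_solution I J c c' P (capcab.M_solution I J s))"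
proof -
  interpret capcab I J c c' P by fact
  have "is_arg_min (offer_cost i j) (\<lambda>C. 0 \<le> C) (Cstar i j)" if "i \<in> I" "j \<in> J" for i j
    using assms(3)[OF that] by (simp only: is_arg_min_offer_cost_iff)
  then show ?thesis
    using ex_M_optimal_with[OF assms(2)] optimal_solution_M_solution[OF assms(2)] by blast
qed

end
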